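(* Assume that each local objective function $f_i$ is $L$-smooth for some constant $L>0$ common to all $i$, and that $f^\ast:=\inf_{x\in\mathbb{R}^d} f(x)>-\infty$. Let $(x^i(t),s^i(t))$ be generated by Algorithm 2 with constant step size $\eta>0$. Suppose $$\eta L\leq\min\left\{\frac{1}{6},\frac{(1-\rho^2)^2}{4\rho^2(3+4\rho^2)}\right\},\qquad R_u:= d\sum_{t=1}^\infty u_t^2<+\infty,$$ and that $u_t$ is non-increasing. Then $\lim_{t\rightarrow\infty} f(\bar x(t))$ exists, and for every $t\ge 1$, $$\frac{1}{t}\sum_{\tau=0}^{t-1}\|\nabla f(\bar x(\tau))\|^2\leq\frac{1}{t}\left[\frac{3.2 (f(\bar x(0))-f^\ast)}{\eta}+ \frac{12.8 L^2 R_0 }{1-\rho^2}+2.4 R_u L^2\right],$$ $$\frac{1}{t}\sum_{\tau=0}^{t-1}\frac{1}{n}\sum_{i=1}^n\|x^i(\tau)-\bar x(\tau)\|^2\leq\frac{1}{t}\left[1.6\eta(f(\bar x(0))-f^\ast)+\frac{3.2 R_0}{1-\rho^2}+0.35 R_u\right],$$ $$\frac{1}{t}\sum_{\tau=1}^{t}\frac{1}{n}\sum_{i=1}^n\|s^i(\tau)-\nabla f(\bar x(\tau-1))\|^2\leq\frac{1}{t}\left[9.6L(f(\bar x(0))-f^\ast)+\frac{19.2 L R_0}{\eta(1-\rho^2)}+\frac{2.35}{\eta}LR_u\right].$$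
   Context: Setting: $n$ agents are the nodes of an undirected connected graph $\mathcal{G}=(\{1,\dots,n\},\mathcal{E})$; agent $i$ has a local objective $f_i:\mathbb{R}^d\to\mathbb{R}$, and $f=\frac1n\sum_{i=1}^n f_i$. $\|\cdot\|$ is the $\ell_2$ norm. A function $h:\mathbb{R}^d\to\mathbb{R}$ is $L$-smooth if it is continuously differentiable with $\|\nabla h(x)-\nabla h(y)\|\le L\|x-y\|$ for all $x,y$. Consensus matrix: $W=[W_{ij}]\in\mathbb{R}^{n\times n}$ is doubly stochastic, $W_{ii}>0$ for all $i$, and for $i\ne j$, $W_{ij}>0$ if and only if $(i,j)\in\mathcal{E}$. Put $\rho:=\|W-n^{-1}\mathbf{1}_n\mathbf{1}_n^\top\|$ (spectral norm); it is known that $\rho<1$. $2d$-point gradient estimator: for $u>0$, $\mathsf{G}^{(2d)}_h(x;u):=\sum_{k=1}^d\frac{h(x+ue_k)-h(x-ue_k)}{2u}e_k$, with $\{e_k\}_{k=1}^d$ the standard basis of $\mathbb{R}^d$. Algorithm 2 (with constant step size $\eta>0$ and radii $u_t>0$): given initial points $x^i(0)\in\mathbb{R}^d$, set $s^i(0)=g^i(0)=0$ for each $i$; for $t=1,2,\dots$ and each $i$ set $g^i(t)=\mathsf{G}^{(2d)}_{f_i}(x^i(t-1);u_t)$, $s^i(t)=\sum_{j=1}^n W_{ij}(s^j(t-1)+g^j(t)-g^j(t-1))$, and $x^i(t)=\sum_{j=1}^n W_{ij}(x^j(t-1)-\eta s^j(t))$. Notation: $\bar x(t):=\frac1n\sum_{i=1}^n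 x^i(t)$ and $$R_0:=\frac{1}{n}\sum_{i=1}^n\left(\frac{\eta \rho^2 }{2L}\|\nabla f_i(x^i(0))\|^2+\|x^i(0)-\bar x(0)\|^2\right)+\frac{\eta\rho^2 u_1^2 Ld}{4}.$$ *)

theory Defs
  imports "HOL-Analysis.Analysis"
begin

definition gradient :: "('a::real_inner \<Rightarrow> real) \<Rightarrow> 'a \<Rightarrow> 'a" where
  "gradient h x = (THE D. GDERIV h x :> D)"

lemma gradient_eqI:
  assumes "GDERIV h x :> D"
  shows "gradient h x = D"
  unfolding gradient_def
proof (rule the_equality)
  fix D' assume "GDERIV h x :> D'"
  then show "D' = D"
    using assms unfolding gderiv_def
    by (metis has_derivative_unique inner_commute vector_eq_rdot)
qed (fact assms)

lemma gderiv_gradient: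
  fixes h :: "'a::euclidean_space \<Rightarrow> real"
  assumes "h differentiable (at x)"
  shows "GDERIV h x :> gradient h x"
proof -
  obtain h' where h': "(h has_derivative h') (at x)"
    using assms unfolding differentiable_def by blast
  interpret bounded_linear h' using h' by (rule has_derivative_bounded_linear)
  have "h' v = v \<bullet> (\<Sum>b\<in>Basis. h' b *\<^sub>R b)" for v
  proof -
    have "h' v = h' (\<Sum>b\<in>Basis. (v \<bullet> b) *\<^sub>R b)" by (simp add: euclidean_representation)
    also have "\<dots> = v \<bullet> (\<Sum>b\<in>Basis. h' b *\<^sub>R b)"
      by (simp add: sum scaleR inner_sum_right mult.commute)
    finally show ?thesis .
  qed
  then have "h' = (\<lambda>v. v \<bullet> (\<Sum>b\<in>Basis. h' b *\<^sub>R b))" by blast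
  then have "GDERIV h x :> (\<Sum>b\<in>Basis. h' b *\<^sub>R b)"
    using h' unfolding gderiv_def by metis
  then show ?thesis using gradient_eqI by metis
qed

definition L_smooth :: "real \<Rightarrow> ('a::euclidean_space \<Rightarrow> real) \<Rightarrow> bool" where
  "L_smooth L h \<longleftrightarrow>
     (\<forall>x. h differentiable (at x)) \<and>
     continuous_on UNIV (gradient h) \<and>
     (\<forall>x y. norm (gradient h x - gradient h y) \<le> L * norm (x - y))"

definition agent_mean :: "('n::finite \<Rightarrow> 'a::real_vector) \<Rightarrow> 'a" where
  "agent_mean v = (1 / real CARD('n)) *\<^sub>R (\<Sum>i\<in>UNIV. v i)"

definition undirected_connected :: "('n \<times> 'n) set \<Rightarrow> bool" where
  "undirected_connected E \<longleftrightarrow> sym E \<and> (\<forall>i j. (i, j) \<in> E\<^sup>*)"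

definition doubly_stochastic :: "real ^ 'n ^ 'n \<Rightarrow> bool" where
  "doubly_stochastic W \<longleftrightarrow>
     (\<forall>i j. 0 \<le> W $ i $ j) \<and>
     (\<forall>i. (\<Sum>j\<in>UNIV. W $ i $ j) = 1) \<and>
     (\<forall>j. (\<Sum>i\<in>UNIV. W $ i $ j) = 1)"

definition consensus_matrix :: "('n::finite \<times> 'n) set \<Rightarrow> real ^ 'n ^ 'n \<Rightarrow> bool" where
  "consensus_matrix E W \<longleftrightarrow>
     doubly_stochastic W \<and>
     (\<forall>i. 0 < W $ i $ i) \<and>
     (\<forall>i j. i \<noteq> j \<longrightarrow> (0 < W $ i $ j \<longleftrightarrow> (i, j) \<in> E))"

definition consensus_rho :: "real ^ 'n ^ 'n \<Rightarrow> real" where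
  "consensus_rho W = onorm ((*v) (W - (\<chi> i j. 1 / real CARD('n))))"

definition grad_est_2d :: "(real ^ 'd \<Rightarrow> real) \<Rightarrow> real ^ 'd \<Rightarrow> real \<Rightarrow> real ^ 'd" where
  "grad_est_2d h x u =
     (\<Sum>k\<in>UNIV. ((h (x + u *\<^sub>R axis k 1) - h (x - u *\<^sub>R axis k 1)) / (2 * u)) *\<^sub>R axis k 1)"

text \<open>
  Time is the first argument of the trajectories, the agent the second. The initial points
  \<open>x 0\<close> are unconstrained, and \<open>u 0\<close> is never used: the radii are \<open>u 1, u 2, \<dots>\<close>.
\<close>

definition gradient_tracking_run ::
    "real ^ 'n ^ 'n \<Rightarrow> ('n::finite \<Rightarrow> real ^ 'd \<Rightarrow> real) \<Rightarrow> real \<Rightarrow> (nat \<Rightarrow> real) \<Rightarrow>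
     (nat \<Rightarrow> 'n \<Rightarrow> real ^ 'd) \<Rightarrow> (nat \<Rightarrow> 'n \<Rightarrow> real ^ 'd) \<Rightarrow> (nat \<Rightarrow> 'n \<Rightarrow> real ^ 'd) \<Rightarrow> bool" where
  "gradient_tracking_run W f \<eta> u x s g \<longleftrightarrow>
     (\<forall>i. s 0 i = 0 \<and> g 0 i = 0) \<and>
     (\<forall>t\<ge>1. \<forall>i.
        g t i = grad_est_2d (f i) (x (t - 1) i) (u t) \<and>
        s t i = (\<Sum>j\<in>UNIV. W $ i $ j *\<^sub>R (s (t - 1) j + g t j - g (t - 1) j)) \<and>
        x t i = (\<Sum>j\<in>UNIV. W $ i $ j *\<^sub>R (x (t - 1) j - \<eta> *\<^sub>R s t j)))"

definition R_init ::
    "real ^ 'n ^ 'n \<Rightarrow> ('n::finite \<Rightarrow> real ^ 'd \<Rightarrow> real) \<Rightarrow> real \<Rightarrow> real \<Rightarrow> real \<Rightarrow>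
     ('n \<Rightarrow> real ^ 'd) \<Rightarrow> real" where
  "R_init W f L \<eta> u1 x0 =
     agent_mean (\<lambda>i. \<eta> * (consensus_rho W)\<^sup>2 / (2 * L) * (norm (gradient (f i) (x0 i)))\<^sup>2
                     + (norm (x0 i - agent_mean x0))\<^sup>2)
     + \<eta> * (consensus_rho W)\<^sup>2 * u1\<^sup>2 * L * real CARD('d) / 4"

text \<open>
  \<^term>\<open>consensus_rho W\<close> vanishes e.g. for a single agent or for uniform averaging. The bound
  on the step size that has \<open>\<rho>\<^sup>2\<close> in its denominator is then infinite, whereas division
  by zero in HOL would make it \<open>0\<close>; hence the case distinction.
\<close>

definition step_bound :: "real \<Rightarrow> real" where
  "step_bound \<rho> =
     (if \<rho> = 0 then 1 / 6
      else min (1 / 6) ((1 - \<rho>\<^sup>2)\<^sup>2 / (4 * \<rho>\<^sup>2 * (3 + 4 * \<rho>\<^sup>2))))"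

end

theory Submission
  imports Defs
begin

text \<open>
  The averages \<open>xbar\<close> follow an inexact gradient descent on \<open>F\<close>, because mixing preserves averages
  and the trackers \<open>s\<close> have the same average as the gradient estimates (\<open>mean_s\<close>). The error of
  the average estimate has two sources: the finite differences, which cost \<open>L\<^sup>2 * d * u\<^sup>2 / 4\<close>
  per agent (\<open>grad_est_2d_error\<close>), and the consensus error, the spread of the agents around their
  average (\<open>mean_gradient_error\<close>). Descent then bounds the sum of the squared gradients by the gap
  to the infimum plus these errors (\<open>descent\<close>), and it remains to bound the total consensus error.

  The consensus error and the tracking error, the spread of the trackers, both contract, since
  mixing shrinks a spread by \<open>\<rho>\<^sup>2\<close> (\<open>disagreement_mix_le\<close>). They force each other: the consensus error
  is driven by \<open>\<eta>\<^sup>2\<close> times the tracking error (\<open>consensus_error_Suc\<close>), and the tracking error by the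
  change of the gradient estimates (\<open>tracking_error_Suc\<close>). By smoothness this change is controlled
  by the motion of the iterates, that is, by the consensus error again, by the length of the averaged
  step, and by the radii (\<open>estimate_change\<close>). Summed over time (\<open>sum_le_of_contraction\<close>), these are
  linear inequalities between totals. The bound on \<open>\<eta> * L\<close> makes the gain of the feedback loop
  smaller than one, and the length of the averaged steps is absorbed by the descent; solving the system
  gives the three bounds (\<open>tracking_totals_bounds\<close>).

  That \<open>\<rho> < 1\<close> follows from strict convexity: equality in Jensen's inequality for the rows of \<open>W\<close>
  makes neighbours agree, and the graph is connected (\<open>consensus_rho_less_1\<close>). Finally, the
  objective at the averages converges since it increases by at most a summable amount.
\<close>

section \<open>Averages over the agents\<close>

lemma agent_mean_add: "agent_mean (\<lambda>i. v i + w i) = agent_mean v + agent_mean w"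
  by (simp add: agent_mean_def sum.distrib scaleR_add_right)

lemma agent_mean_diff: "agent_mean (\<lambda>i. v i - w i) = agent_mean v - agent_mean w"
  by (simp add: agent_mean_def sum_subtractf scaleR_diff_right)

lemma agent_mean_scaleR: "agent_mean (\<lambda>i. c *\<^sub>R v i) = c *\<^sub>R agent_mean v"
  by (simp add: agent_mean_def scaleR_sum_right mult.commute)

lemma agent_mean_mult: "agent_mean (\<lambda>i. c * v i) = c * (agent_mean v :: real)"
  using agent_mean_scaleR[of c v] by simp

lemma agent_mean_const [simp]: "agent_mean (\<lambda>i::'n::finite. c) = c"
  by (simp add: agent_mean_def scaleR_conv_of_real[symmetric] sum_constant_scaleR)

lemma agent_mean_inner: "agent_mean (\<lambda>i. v i \<bullet> c) = agent_mean v \<bullet> c"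
  by (simp add: agent_mean_def inner_sum_left)

lemma agent_mean_mono:
  fixes v w :: "'n::finite \<Rightarrow> real"
  assumes "\<And>i. v i \<le> w i"
  shows "agent_mean v \<le> agent_mean w"
  using assms by (auto simp: agent_mean_def intro!: divide_right_mono sum_mono)

text \<open>
  Everything below is measured in the normalised \<open>\<ell>\<^sub>2\<close> norm on the product of the agents' spaces.
  The orthogonal splitting into the average and the deviation from it is what separates the
  dynamics of the averages from the consensus error.
\<close>

definition mean_sq :: "('n::finite \<Rightarrow> 'a::real_inner) \<Rightarrow> real" where
  "mean_sq v = agent_mean (\<lambda>i. (norm (v i))\<^sup>2)"

definition disagreement :: "('n::finite \<Rightarrow> 'a::real_inner) \<Rightarrow> real" where
  "disagreement v = mean_sq (\<lambda>i. v i - agent_mean v)"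

lemma mean_sq_nonneg: "0 \<le> mean_sq v"
  unfolding mean_sq_def using agent_mean_mono[of "\<lambda>i. 0" "\<lambda>i. (norm (v i))\<^sup>2"] by simp

lemma disagreement_nonneg: "0 \<le> disagreement v"
  by (simp add: disagreement_def mean_sq_nonneg)

text \<open>
  Bias-variance decomposition: the deviations from the average sum to zero, so the cross term
  vanishes.
\<close>

lemma mean_sq_shift:
  "mean_sq (\<lambda>i. v i - c) = disagreement v + (norm (agent_mean v - c))\<^sup>2"
proof -
  let ?m = "agent_mean v"
  have pt: "(norm (v i - c))\<^sup>2 = (norm (v i - ?m))\<^sup>2 + 2 * ((v i - ?m) \<bullet> (?m - c)) + (norm (?m - c))\<^sup>2" for i
    by (simp add: power2_norm_eq_inner algebra_simps inner_commute)
  have "agent_mean (\<lambda>i. (v i - ?m) \<bullet> (?m - c)) = 0"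
    by (simp only: agent_mean_inner agent_mean_diff agent_mean_const) simp
  then show ?thesis
    unfolding disagreement_def mean_sq_def pt
    by (simp add: agent_mean_add agent_mean_mult)
qed

lemma mean_sq_split: "mean_sq v = disagreement v + (norm (agent_mean v))\<^sup>2"
  using mean_sq_shift[of v 0] by simp

lemma disagreement_le_mean_sq: "disagreement v \<le> mean_sq v"
  using mean_sq_split[of v] by simp

lemma norm_agent_mean_le: "(norm (agent_mean v))\<^sup>2 \<le> mean_sq v"
  using mean_sq_split[of v] disagreement_nonneg[of v] by simp

lemma norm_add_sq_le: "(norm (a + b))\<^sup>2 \<le> 2 * (norm a)\<^sup>2 + 2 * (norm b)\<^sup>2" for a b :: "'a::real_inner"
proof -
  have "0 \<le> (norm (a - b))\<^sup>2" by simp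
  then show ?thesis
    by (simp add: power2_norm_eq_inner algebra_simps inner_commute)
qed

text \<open>
  Young's inequality with its parameter tuned so that the factor \<open>r\<close> still leaves a contraction,
  by \<open>(1 + r) / 2\<close>, for the first summand. Keeping the factor \<open>r\<close> on the left makes the inequality
  meaningful at \<open>r = 0\<close>, where the usual parameter \<open>(1 - r) / (2 * r)\<close> is infinite. The difference
  of the two sides is a perfect square.
\<close>

lemma norm_add_sq_contracted:
  fixes a b :: "'a::real_inner"
  assumes "0 \<le> r" "r < 1"
  shows "r * (norm (a + b))\<^sup>2 \<le> (1 + r) / 2 * (norm a)\<^sup>2 + r * (1 + r) / (1 - r) * (norm b)\<^sup>2"
proof -
  define c where "c = 2 * r / (1 - r)"
  have c: "(1 - r) * c = 2 * r" using assms by (simp add: c_def)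
  have "0 \<le> (1 - r) / 2 * (norm (a - c *\<^sub>R b))\<^sup>2" using assms by simp
  also have "\<dots> = (1 - r) / 2 * (a \<bullet> a) - ((1 - r) * c) * (a \<bullet> b) + ((1 - r) * c) * c / 2 * (b \<bullet> b)"
    by (simp add: power2_norm_eq_inner inner_diff_left inner_diff_right inner_commute)
      (simp add: field_simps)
  also have "\<dots> = (1 - r) / 2 * (a \<bullet> a) - 2 * r * (a \<bullet> b) + (r * c) * (b \<bullet> b)"
    unfolding c by simp
  also have "r * c = r * (1 + r) / (1 - r) - r"
    using assms by (simp add: c_def field_simps)
  finally show ?thesis
    by (simp add: power2_norm_eq_inner algebra_simps inner_commute add_divide_distrib diff_divide_distrib)
qed

lemma disagreement_add_contracted:
  assumes "0 \<le> r" "r < 1"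
  shows "r * disagreement (\<lambda>i. v i + w i)
    \<le> (1 + r) / 2 * disagreement v + r * (1 + r) / (1 - r) * disagreement w"
proof -
  let ?a = "\<lambda>i. v i - agent_mean v" and ?b = "\<lambda>i. w i - agent_mean w"
  have "agent_mean (\<lambda>i. r * (norm (?a i + ?b i))\<^sup>2)
      \<le> agent_mean (\<lambda>i. (1 + r) / 2 * (norm (?a i))\<^sup>2 + r * (1 + r) / (1 - r) * (norm (?b i))\<^sup>2)"
    by (intro agent_mean_mono norm_add_sq_contracted[OF assms])
  moreover have "?a i + ?b i = v i + w i - agent_mean (\<lambda>i. v i + w i)" for i
    by (simp add: agent_mean_add)
  ultimately show ?thesis
    unfolding disagreement_def mean_sq_def
    by (simp only: agent_mean_mult agent_mean_add[of "\<lambda>i. (1 + r) / 2 * _ i"])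
qed

lemma disagreement_diff_le:
  "disagreement (\<lambda>i. v i - w i) \<le> 2 * disagreement v + 2 * disagreement w"
  unfolding disagreement_def mean_sq_def agent_mean_diff agent_mean_mult[symmetric] agent_mean_add[symmetric]
proof (intro agent_mean_mono)
  fix i
  have "v i - w i - (agent_mean v - agent_mean w) = (v i - agent_mean v) + - (w i - agent_mean w)" by simp
  then show "(norm (v i - w i - (agent_mean v - agent_mean w)))\<^sup>2
         \<le> 2 * (norm (v i - agent_mean v))\<^sup>2 + 2 * (norm (w i - agent_mean w))\<^sup>2"
    using norm_add_sq_le[of "v i - agent_mean v" "- (w i - agent_mean w)"] by (simp only: norm_minus_cancel)
qed

lemma disagreement_scaleR: "disagreement (\<lambda>i. c *\<^sub>R v i) = c\<^sup>2 * disagreement v"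
  unfolding disagreement_def mean_sq_def agent_mean_scaleR agent_mean_mult[symmetric]
  by (simp add: scaleR_diff_right[symmetric] power_mult_distrib)

section \<open>Contraction by the consensus matrix\<close>

definition mix :: "real ^ 'n ^ 'n \<Rightarrow> ('n::finite \<Rightarrow> 'a::real_vector) \<Rightarrow> 'n \<Rightarrow> 'a" where
  "mix W v i = (\<Sum>j\<in>UNIV. W $ i $ j *\<^sub>R v j)"

lemma agent_mean_mix:
  assumes "doubly_stochastic W"
  shows "agent_mean (mix W v) = agent_mean v"
proof -
  have "(\<Sum>i\<in>UNIV. \<Sum>j\<in>UNIV. W $ i $ j *\<^sub>R v j) = (\<Sum>j\<in>UNIV. \<Sum>i\<in>UNIV. W $ i $ j *\<^sub>R v j)"
    by (rule sum.swap)
  also have "\<dots> = (\<Sum>j\<in>UNIV. v j)"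
    using assms by (simp add: doubly_stochastic_def flip: scaleR_sum_left)
  finally show ?thesis by (simp add: agent_mean_def mix_def)
qed

lemma mix_diff_const:
  assumes "doubly_stochastic W"
  shows "mix W (\<lambda>j. v j - c) i = mix W v i - c"
  using assms by (simp add: mix_def doubly_stochastic_def scaleR_diff_right sum_subtractf
      flip: scaleR_sum_left)

text \<open>
  The matrix whose norm is \<open>\<rho>\<close> mixes and then removes the average; on vectors of mean zero
  it therefore acts as \<open>W\<close> alone.
\<close>

lemma deviation_matrix_apply:
  fixes W :: "real ^ 'n::finite ^ 'n"
  shows "((W - (\<chi> i j. 1 / real CARD('n))) *v v) $ i = mix W (($) v) i - agent_mean (($) v)"
  by (simp add: matrix_vector_mult_def mix_def agent_mean_def left_diff_distrib sum_subtractf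
      sum_divide_distrib)

lemma mix_sq_le:
  fixes w :: "'n::finite \<Rightarrow> real"
  assumes "agent_mean w = 0"
  shows "(\<Sum>i\<in>UNIV. (mix W w i)\<^sup>2) \<le> (consensus_rho W)\<^sup>2 * (\<Sum>i\<in>UNIV. (w i)\<^sup>2)"
proof -
  let ?A = "W - (\<chi> i j. 1 / real CARD('n))"
  let ?w = "\<chi> i. w i"
  have sq: "(norm z)\<^sup>2 = (\<Sum>i\<in>UNIV. (z $ i)\<^sup>2)" for z :: "real ^ 'n"
    by (simp add: norm_vec_def L2_set_def sum_nonneg)
  have "norm (?A *v ?w) \<le> consensus_rho W * norm ?w"
    unfolding consensus_rho_def by (rule onorm) simp
  then have "(norm (?A *v ?w))\<^sup>2 \<le> (consensus_rho W)\<^sup>2 * (norm ?w)\<^sup>2"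
    by (metis norm_ge_zero power_mono power_mult_distrib)
  moreover have "($) ?w = w" by (rule ext) simp
  ultimately show ?thesis
    unfolding sq deviation_matrix_apply using assms by simp
qed

lemma norm_sq_Basis: "(norm z)\<^sup>2 = (\<Sum>b\<in>Basis. (z \<bullet> b)\<^sup>2)" for z :: "'a::euclidean_space"
  unfolding power2_norm_eq_inner by (subst euclidean_inner) (simp add: power2_eq_square)

text \<open>
  Mixing commutes with subtracting the average, so the scalar contraction can be applied to each
  coordinate of the deviations.
\<close>

lemma disagreement_mix_le:
  fixes v :: "'n::finite \<Rightarrow> 'a::euclidean_space"
  assumes "doubly_stochastic W"
  shows "disagreement (mix W v) \<le> (consensus_rho W)\<^sup>2 * disagreement v"
proof -
  define w where "w i = v i - agent_mean v" for i
  have w0: "agent_mean (\<lambda>i. w i \<bullet> b) = 0" for b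
    unfolding w_def agent_mean_inner agent_mean_diff by simp
  have mw: "mix W v i - agent_mean (mix W v) = mix W w i" for i
    by (simp add: agent_mean_mix[OF assms] mix_diff_const[OF assms] w_def[abs_def])
  have "(\<Sum>i\<in>UNIV. (norm (mix W w i))\<^sup>2) = (\<Sum>b\<in>Basis. \<Sum>i\<in>UNIV. (mix W (\<lambda>j. w j \<bullet> b) i)\<^sup>2)"
    unfolding norm_sq_Basis by (subst sum.swap) (simp add: mix_def inner_sum_left)
  also have "\<dots> \<le> (\<Sum>b\<in>Basis. (consensus_rho W)\<^sup>2 * (\<Sum>i\<in>UNIV. (w i \<bullet> b)\<^sup>2))"
    by (intro sum_mono mix_sq_le w0)
  also have "\<dots> = (consensus_rho W)\<^sup>2 * (\<Sum>i\<in>UNIV. (norm (w i))\<^sup>2)"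
    unfolding norm_sq_Basis by (subst sum.swap) (simp add: sum_distrib_left)
  finally have "mean_sq (mix W w) \<le> (consensus_rho W)\<^sup>2 * mean_sq w"
    unfolding mean_sq_def agent_mean_def by (simp add: divide_right_mono)
  then show ?thesis
    unfolding disagreement_def mw by (simp add: w_def[abs_def] disagreement_def)
qed

text \<open>
  Each row of \<open>W\<close> is a probability distribution, and its variance is the amount by which
  Jensen's inequality is strict; the columns sum to one, so the second moments add up to the
  norm of \<open>w\<close>.
\<close>

lemma mix_variance:
  fixes w :: "'n::finite \<Rightarrow> real"
  assumes "doubly_stochastic W"
  shows "(\<Sum>i\<in>UNIV. (mix W w i)\<^sup>2) + (\<Sum>i\<in>UNIV. \<Sum>j\<in>UNIV. W $ i $ j * (w j - mix W w i)\<^sup>2)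
    = (\<Sum>i\<in>UNIV. (w i)\<^sup>2)"
proof -
  have row: "(\<Sum>j\<in>UNIV. W $ i $ j) = 1" and col: "(\<Sum>i\<in>UNIV. W $ i $ j) = 1" for i j
    using assms by (auto simp: doubly_stochastic_def)
  have "(\<Sum>j\<in>UNIV. W $ i $ j * (w j - mix W w i)\<^sup>2)
      = (\<Sum>j\<in>UNIV. W $ i $ j * (w j)\<^sup>2) - (mix W w i)\<^sup>2" for i
  proof -
    let ?m = "mix W w i"
    have "(\<Sum>j\<in>UNIV. W $ i $ j * (w j - ?m)\<^sup>2)
        = (\<Sum>j\<in>UNIV. W $ i $ j * (w j)\<^sup>2 - 2 * ?m * (W $ i $ j * w j) + ?m\<^sup>2 * W $ i $ j)"
      by (rule sum.cong) (auto simp: power2_eq_square algebra_simps)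
    also have "\<dots> = (\<Sum>j\<in>UNIV. W $ i $ j * (w j)\<^sup>2) - 2 * ?m * (\<Sum>j\<in>UNIV. W $ i $ j * w j) + ?m\<^sup>2"
      by (simp add: sum.distrib sum_subtractf row flip: sum_distrib_left)
    also have "(\<Sum>j\<in>UNIV. W $ i $ j * w j) = ?m" by (simp add: mix_def)
    finally show ?thesis by (simp add: power2_eq_square)
  qed
  then have "(\<Sum>i\<in>UNIV. (mix W w i)\<^sup>2) + (\<Sum>i\<in>UNIV. \<Sum>j\<in>UNIV. W $ i $ j * (w j - mix W w i)\<^sup>2)
      = (\<Sum>i\<in>UNIV. \<Sum>j\<in>UNIV. W $ i $ j * (w j)\<^sup>2)"
    by (simp add: sum_subtractf)
  also have "\<dots> = (\<Sum>j\<in>UNIV. \<Sum>i\<in>UNIV. W $ i $ j * (w j)\<^sup>2)" by (rule sum.swap)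
  finally show ?thesis by (simp add: col flip: sum_distrib_right)
qed

text \<open>
  If mixing preserved the norm, every row variance would vanish: each agent would agree with all
  agents to which it gives positive weight. The diagonal is positive, so the common value of a row
  is the agent's own value, and agreement spreads along the edges of the connected graph.
  A constant vector of mean zero is zero.
\<close>

lemma mix_sq_less:
  fixes w :: "'n::finite \<Rightarrow> real"
  assumes conn: "undirected_connected E" and W: "consensus_matrix E W"
    and w0: "agent_mean w = 0" and wne: "w k \<noteq> 0"
  shows "(\<Sum>i\<in>UNIV. (mix W w i)\<^sup>2) < (\<Sum>i\<in>UNIV. (w i)\<^sup>2)"
proof (rule ccontr)
  assume "\<not> ?thesis"
  moreover have ds: "doubly_stochastic W" and diag: "\<And>i. 0 < W $ i $ i"
    and edge: "\<And>i j. (i, j) \<in> E \<Longrightarrow> i \<noteq> j \<Longrightarrow> 0 < W $ i $ j"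
    using W by (auto simp: consensus_matrix_def)
  moreover have nn: "0 \<le> W $ i $ j" for i j using ds by (simp add: doubly_stochastic_def)
  then have tn: "0 \<le> W $ i $ j * (w j - mix W w i)\<^sup>2" for i j by simp
  ultimately have "(\<Sum>i\<in>UNIV. \<Sum>j\<in>UNIV. W $ i $ j * (w j - mix W w i)\<^sup>2) = 0"
    using mix_variance[OF ds, of w] by (intro antisym sum_nonneg) auto
  then have z: "W $ i $ j * (w j - mix W w i)\<^sup>2 = 0" for i j
    using tn by (simp add: sum_nonneg_eq_0_iff sum_nonneg)
  have own: "w i = mix W w i" for i using z[of i i] diag[of i] by simp
  have adj: "w j = w i" if "(i, j) \<in> E" for i j
    using z[of i j] edge[OF that] own[of i] by (cases "i = j") auto
  have "w j = w k" for j
  proof -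
    have "(k, j) \<in> E\<^sup>*" using conn by (simp add: undirected_connected_def)
    then show ?thesis by induction (use adj in auto)
  qed
  then have "w = (\<lambda>j. w k)" by auto
  then show False using w0 wne agent_mean_const[of "w k"] by metis
qed

lemma consensus_rho_nonneg: "0 \<le> consensus_rho W"
  unfolding consensus_rho_def by (rule onorm_pos_le) simp

text \<open>
  A strict decrease of the norm at every nonzero vector bounds the operator norm strictly below
  one, since the norm is attained on the compact unit sphere.
\<close>

lemma consensus_rho_less_1:
  fixes W :: "real ^ 'n::finite ^ 'n"
  assumes conn: "undirected_connected E" and W: "consensus_matrix E W"
  shows "consensus_rho W < 1"
proof -
  let ?A = "W - (\<chi> i j. 1 / real CARD('n))"
  have ds: "doubly_stochastic W" using W by (simp add: consensus_matrix_def)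
  have less: "norm (?A *v v) < norm v" if "v \<noteq> 0" for v
  proof -
    have sq: "(norm z)\<^sup>2 = (\<Sum>i\<in>UNIV. (z $ i)\<^sup>2)" for z :: "real ^ 'n"
      by (simp add: norm_vec_def L2_set_def sum_nonneg)
    define w where "w i = v $ i - agent_mean (($) v)" for i
    have w0: "agent_mean w = 0" by (simp add: w_def[abs_def] agent_mean_diff)
    have Av: "(norm (?A *v v))\<^sup>2 = (\<Sum>i\<in>UNIV. (mix W w i)\<^sup>2)"
      unfolding sq deviation_matrix_apply w_def[abs_def] mix_diff_const[OF ds] ..
    have "mean_sq w = disagreement (($) v)" by (simp add: disagreement_def w_def[abs_def])
    then have "mean_sq w \<le> mean_sq (($) v)" by (simp add: disagreement_le_mean_sq)
    then have le: "(\<Sum>i\<in>UNIV. (w i)\<^sup>2) \<le> (norm v)\<^sup>2"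
      unfolding sq mean_sq_def agent_mean_def by (simp add: divide_le_cancel)
    have "(norm (?A *v v))\<^sup>2 < (norm v)\<^sup>2"
    proof (cases "\<exists>k. w k \<noteq> 0")
      case True
      then show ?thesis using mix_sq_less[OF conn W w0] Av le by fastforce
    next
      case False
      then show ?thesis using Av that by (simp add: mix_def)
    qed
    then show ?thesis by (rule power_less_imp_less_base) simp
  qed
  have "continuous_on (sphere 0 1) (\<lambda>v. norm (?A *v v))"
    by (intro continuous_intros linear_continuous_on) simp
  moreover have "sphere (0::real ^ 'n) 1 \<noteq> {}" by simp
  ultimately obtain v where v: "v \<in> sphere (0::real ^ 'n) 1"
    and max: "\<And>y. y \<in> sphere 0 1 \<Longrightarrow> norm (?A *v y) \<le> norm (?A *v v)"
    using continuous_attains_sup[OF compact_sphere] by metis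
  have "norm (?A *v y) \<le> norm (?A *v v) * norm y" for y
  proof (cases "y = 0")
    case False
    then have "norm (?A *v ((1 / norm y) *\<^sub>R y)) \<le> norm (?A *v v)" by (intro max) simp
    then show ?thesis using False
      by (simp add: matrix_vector_mult_scaleR divide_le_eq)
  qed simp
  then have "consensus_rho W \<le> norm (?A *v v)" unfolding consensus_rho_def by (intro onorm_le)
  also have "\<dots> < 1" using less[of v] v by force
  finally show ?thesis .
qed

section \<open>Smooth functions and the gradient estimator\<close>

text \<open>
  Along the segment from \<open>x\<close> to \<open>y\<close>, the Taylor remainder minus \<open>L / 2 * t\<^sup>2 * (norm (y - x))\<^sup>2\<close>
  has a nonpositive derivative, by the Lipschitz condition on the gradient.
\<close>

lemma L_smooth_quadratic_bound:
  fixes h :: "'a::euclidean_space \<Rightarrow> real"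
  assumes "L_smooth L h"
  shows "\<bar>h y - h x - gradient h x \<bullet> (y - x)\<bar> \<le> L / 2 * (norm (y - x))\<^sup>2"
proof -
  define d where "d = y - x"
  have der: "GDERIV h z :> gradient h z" for z
    using assms by (intro gderiv_gradient) (simp add: L_smooth_def)
  have line: "((\<lambda>t. h (x + t *\<^sub>R d)) has_real_derivative gradient h (x + t *\<^sub>R d) \<bullet> d) (at t)" for t
  proof -
    have "(h has_derivative (\<lambda>v. v \<bullet> gradient h (x + t *\<^sub>R d))) (at (x + t *\<^sub>R d))"
      using der[of "x + t *\<^sub>R d"] by (simp add: gderiv_def)
    moreover have "((\<lambda>t. x + t *\<^sub>R d) has_derivative (\<lambda>s. s *\<^sub>R d)) (at t)"
      by (auto intro!: derivative_eq_intros)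
    ultimately have "((\<lambda>t. h (x + t *\<^sub>R d)) has_derivative
        (\<lambda>s. (s *\<^sub>R d) \<bullet> gradient h (x + t *\<^sub>R d))) (at t)"
      by (rule has_derivative_compose[rotated])
    then show ?thesis
      by (simp add: has_field_derivative_def inner_commute mult_commute_abs)
  qed
  \<comment> \<open>The sign \<open>c\<close> treats the upper and the lower bound at once.\<close>
  have main: "c * (h y - h x - gradient h x \<bullet> d) \<le> L / 2 * (norm d)\<^sup>2" if c: "\<bar>c\<bar> = 1" for c :: real
  proof -
    define p where "p t = c * (h (x + t *\<^sub>R d) - t * (gradient h x \<bullet> d)) - L / 2 * (norm d)\<^sup>2 * t\<^sup>2" for t
    have "p 1 \<le> p 0"
    proof (rule DERIV_nonpos_imp_nonincreasing[where f = p])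
      fix t :: real assume t: "0 \<le> t" "t \<le> 1"
      have "(p has_real_derivative c * ((gradient h (x + t *\<^sub>R d) - gradient h x) \<bullet> d)
          - L * (norm d)\<^sup>2 * t) (at t)"
        unfolding p_def[abs_def] by (rule derivative_eq_intros line refl)+ (simp add: algebra_simps)
      moreover have "c * ((gradient h (x + t *\<^sub>R d) - gradient h x) \<bullet> d) \<le> L * (norm d)\<^sup>2 * t"
      proof -
        have "c * ((gradient h (x + t *\<^sub>R d) - gradient h x) \<bullet> d)
            \<le> \<bar>c * ((gradient h (x + t *\<^sub>R d) - gradient h x) \<bullet> d)\<bar>" by simp
        also have "\<dots> \<le> norm (gradient h (x + t *\<^sub>R d) - gradient h x) * norm d"
          using c Cauchy_Schwarz_ineq2 by (simp add: abs_mult)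
        also have "\<dots> \<le> L * norm (x + t *\<^sub>R d - x) * norm d"
          using assms by (intro mult_right_mono) (auto simp only: L_smooth_def norm_ge_zero)
        also have "\<dots> = L * (norm d)\<^sup>2 * t" using t by (simp add: power2_eq_square)
        finally show ?thesis .
      qed
      ultimately show "\<exists>y. (p has_real_derivative y) (at t) \<and> y \<le> 0" by force
    qed simp
    then show ?thesis by (simp add: p_def d_def algebra_simps)
  qed
  show ?thesis using main[of 1, simplified] main[of "-1", simplified] unfolding d_def by (intro abs_leI) linarith+
qed

text \<open>
  Two applications of the quadratic bound, at \<open>x \<plusminus> u * e\<^sub>k\<close>, show that each partial derivative is
  estimated with error at most \<open>L * u / 2\<close>.
\<close>

lemma grad_est_2d_error:
  fixes h :: "real ^ 'd \<Rightarrow> real"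
  assumes "L_smooth L h" "0 < u"
  shows "(norm (grad_est_2d h x u - gradient h x))\<^sup>2 \<le> L\<^sup>2 * (real CARD('d) * u\<^sup>2) / 4"
proof -
  have comp: "grad_est_2d h x u $ k
      = (h (x + u *\<^sub>R axis k 1) - h (x - u *\<^sub>R axis k 1)) / (2 * u)" for k
    by (simp add: grad_est_2d_def axis_def if_distrib cong: if_cong)
  have err: "((grad_est_2d h x u - gradient h x) $ k)\<^sup>2 \<le> (L * u / 2)\<^sup>2" for k
  proof -
    let ?e = "axis k (1::real) :: real ^ 'd"
    have "\<bar>h (x + u *\<^sub>R ?e) - h x - u * (gradient h x $ k)\<bar> \<le> L / 2 * u\<^sup>2"
      using L_smooth_quadratic_bound[OF assms(1), of "x + u *\<^sub>R ?e" x] assms(2)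
      by (simp add: inner_axis norm_axis_1)
    moreover have "\<bar>h (x - u *\<^sub>R ?e) - h x + u * (gradient h x $ k)\<bar> \<le> L / 2 * u\<^sup>2"
      using L_smooth_quadratic_bound[OF assms(1), of "x - u *\<^sub>R ?e" x] assms(2)
      by (simp add: inner_axis norm_axis_1)
    ultimately have "\<bar>h (x + u *\<^sub>R ?e) - h (x - u *\<^sub>R ?e) - 2 * u * (gradient h x $ k)\<bar> \<le> L * u\<^sup>2"
      by linarith
    then have "\<bar>h (x + u *\<^sub>R ?e) - h (x - u *\<^sub>R ?e) - 2 * u * (gradient h x $ k)\<bar> / (2 * u)
        \<le> L * u\<^sup>2 / (2 * u)"
      using assms(2) by (intro divide_right_mono) auto
    moreover have "(grad_est_2d h x u - gradient h x) $ k
        = (h (x + u *\<^sub>R ?e) - h (x - u *\<^sub>R ?e) - 2 * u * (gradient h x $ k)) / (2 * u)"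
      using assms(2) by (simp add: comp field_simps)
    ultimately have "\<bar>(grad_est_2d h x u - gradient h x) $ k\<bar> \<le> L * u / 2"
      using assms(2) by (simp add: abs_divide power2_eq_square)
    then show ?thesis by (metis abs_ge_zero power2_abs power_mono)
  qed
  have "(norm (grad_est_2d h x u - gradient h x))\<^sup>2
      = (\<Sum>k\<in>UNIV. ((grad_est_2d h x u - gradient h x) $ k)\<^sup>2)"
    by (simp add: norm_vec_def L2_set_def sum_nonneg)
  also have "\<dots> \<le> (\<Sum>k\<in>(UNIV::'d set). (L * u / 2)\<^sup>2)" by (intro sum_mono err)
  also have "\<dots> = L\<^sup>2 * (real CARD('d) * u\<^sup>2) / 4" by (simp add: power2_eq_square)
  finally show ?thesis .
qed

lemma gradient_agent_mean:
  fixes f :: "'n::finite \<Rightarrow> 'a::euclidean_space \<Rightarrow> real"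
  assumes "\<And>i. f i differentiable (at y)"
  shows "gradient (\<lambda>y. agent_mean (\<lambda>i. f i y)) y = agent_mean (\<lambda>i. gradient (f i) y)"
proof (rule gradient_eqI)
  have "(f i has_derivative (\<lambda>v. v \<bullet> gradient (f i) y)) (at y)" for i
    using gderiv_gradient[OF assms] by (simp add: gderiv_def)
  then have "((\<lambda>y. agent_mean (\<lambda>i. f i y)) has_derivative
      (\<lambda>v. (1 / real CARD('n)) *\<^sub>R (\<Sum>i\<in>UNIV. v \<bullet> gradient (f i) y))) (at y)"
    unfolding agent_mean_def by (intro has_derivative_scaleR_right has_derivative_sum)
  then show "GDERIV (\<lambda>y. agent_mean (\<lambda>i. f i y)) y :> agent_mean (\<lambda>i. gradient (f i) y)"
    by (simp add: gderiv_def agent_mean_def inner_sum_right)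
qed

text \<open>
  Summing the recursion moves the contracted part to the left. The last term on the left is kept
  without a matching \<open>b T\<close>: this lets the tracking error up to some time be bounded by estimates
  that involve only earlier iterates.
\<close>

lemma sum_le_of_contraction:
  fixes a b :: "nat \<Rightarrow> real"
  assumes c: "0 \<le> c" and a: "\<And>t. 0 \<le> a t" and step: "\<And>t. a (Suc t) \<le> c * a t + b t"
  shows "(1 - c) * (\<Sum>t<Suc T. a t) \<le> a 0 + (\<Sum>t<T. b t)"
proof -
  have "(1 - c) * (\<Sum>t<T. a t) + a T \<le> a 0 + (\<Sum>t<T. b t)"
  proof (induction T)
    case (Suc T)
    then show ?case using step[of T] by (simp add: algebra_simps)
  qed simp
  moreover have "(1 - c) * a T \<le> a T" using c a[of T] by (simp add: algebra_simps)
  ultimately show ?thesis by (simp add: distrib_left)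
qed

text \<open>
  The factor multiplying \<open>a\<close> is the gain from a forcing term to the total of a contracted
  sequence. This is the only place where the bound on the step size in terms of \<open>\<rho>\<close> enters; it
  keeps the gain around the feedback loop of the two error recursions below one.
\<close>

lemma contraction_times_step_le:
  fixes a r :: real
  assumes r: "0 \<le> r" "r < 1" and a: "0 \<le> a" and step: "4 * r * (3 + 4 * r) * a \<le> (1 - r)\<^sup>2"
  shows "2 * (r * (1 + r) / (1 - r)) / (1 - r) * a \<le> 1 / 6"
proof -
  have "12 * r * (1 + r) * a \<le> 4 * r * (3 + 4 * r) * a"
    using r a by (intro mult_right_mono) (auto simp: algebra_simps)
  then have "12 * (r * (1 + r) * a) \<le> (1 - r)\<^sup>2" using step by linarith
  then have "2 * (r * (1 + r) * a) / (1 - r)\<^sup>2 \<le> 1 / 6"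
    using r by (subst pos_divide_le_eq) auto
  then show ?thesis by (simp add: power2_eq_square mult.assoc)
qed

text \<open>
  The algebra that closes the loop. All quantities are totals over a time window:
  \<open>SX\<close> of the consensus errors, \<open>SS\<close> of the tracking errors, \<open>SD\<close> of the squared changes of the
  gradient estimates, \<open>SG\<close> of the squared average estimates, \<open>SN\<close> of the squared gradients, \<open>SE\<close> of the
  squared errors of the average estimates, and \<open>U\<close> of \<open>d\<close> times the squared radii.
  Rescaled to \<open>z = \<eta> / L * SS\<close> and \<open>G = \<eta>\<^sup>2 * SG\<close>, the loop reads
  \<open>SX \<le> 2 * p + z / 6\<close> and \<open>z \<le> 8 * q + 4 / 3 * SX + G / 3 + U / 3\<close>. Eliminating \<open>z\<close> leaves the
  coefficient \<open>1 - 2 / 9\<close> in front of \<open>SX\<close>, and the remaining multiple of \<open>G\<close> is so small that the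
  descent inequality absorbs it.
\<close>

lemma tracking_totals_bounds:
  fixes SX SS SG SN SE SD U \<Delta> L \<eta> r X0 S1 R0 :: real
  defines "\<gamma> \<equiv> r * (1 + r) / (1 - r)"
  assumes r: "0 \<le> r" "r < 1" and L: "0 < L" and \<eta>: "0 < \<eta>"
    and step: "\<eta> * L \<le> 1 / 6" "4 * r * (3 + 4 * r) * (\<eta> * L) \<le> (1 - r)\<^sup>2"
    and X: "(1 - (1 + r) / 2) * SX \<le> X0 + \<gamma> * \<eta>\<^sup>2 * SS"
    and S: "(1 - (1 + r) / 2) * SS \<le> S1 + \<gamma> * SD"
    and D: "SD \<le> 8 * L\<^sup>2 * SX + 2 * L\<^sup>2 * \<eta>\<^sup>2 * SG + 2 * L\<^sup>2 * U"
    and N: "SN / 2 + (1 - \<eta> * L) / 2 * SG \<le> \<Delta> / \<eta> + SE / 2"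
    and E: "SE \<le> 2 * L\<^sup>2 * SX + L\<^sup>2 * U / 2"
    and R: "X0 + \<eta> / (4 * L) * S1 \<le> R0"
    and nonneg: "0 \<le> SX" "0 \<le> SS" "0 \<le> SG" "0 \<le> SN" "0 \<le> SD" "0 \<le> U" "0 \<le> X0" "0 \<le> S1" "0 \<le> \<Delta>"
  shows "SN \<le> 3.2 * \<Delta> / \<eta> + 12.8 * L\<^sup>2 * R0 / (1 - r) + 2.4 * U * L\<^sup>2"
    and "SX \<le> 1.6 * \<eta> * \<Delta> + 3.2 * R0 / (1 - r) + 0.35 * U"
    and "SS + SE \<le> 9.6 * L * \<Delta> + 19.2 * L * R0 / (\<eta> * (1 - r)) + 2.35 / \<eta> * L * U"
proof -
  define a where "a = \<eta> * L"
  define \<kappa> where "\<kappa> = 2 * \<gamma> / (1 - r)"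
  have a: "0 < a" "a \<le> 1 / 6" using L \<eta> step by (auto simp: a_def)
  have \<kappa>a: "\<kappa> * a \<le> 1 / 6"
    unfolding \<kappa>_def \<gamma>_def using contraction_times_step_le[OF r _ step(2)] a by (simp add: a_def)
  have a2: "a\<^sup>2 \<le> 1 / 36"
    using a power_mono[of a "1/6" 2] by (simp add: power2_eq_square)
  \<comment> \<open>The initial errors enter with the weights with which they occur in \<open>R0\<close>.\<close>
  define p where "p = X0 / (1 - r)"
  define q where "q = \<eta> / (4 * L) * S1 / (1 - r)"
  define Q where "Q = R0 / (1 - r)"
  define z where "z = \<eta> / L * SS"
  define G where "G = \<eta>\<^sup>2 * SG"
  have pos: "0 \<le> p" "0 \<le> q" "0 \<le> z" "0 \<le> G"
    using r L \<eta> nonneg by (auto simp: p_def q_def z_def G_def)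
  have pq: "p + q \<le> Q"
    using divide_right_mono[OF R, of "1 - r"] r by (simp add: p_def q_def Q_def add_divide_distrib)
  have "SX \<le> 2 * p + (\<kappa> * a) * z"
  proof -
    have "(1 - r) * SX \<le> 2 * (X0 + \<gamma> * \<eta>\<^sup>2 * SS)" using X by (simp add: field_simps)
    then have "SX \<le> 2 * (X0 + \<gamma> * \<eta>\<^sup>2 * SS) / (1 - r)" using r by (simp add: field_simps)
    also have "\<dots> = 2 * p + (\<kappa> * a) * z"
      using L r by (simp add: p_def \<kappa>_def a_def z_def add_divide_distrib power2_eq_square)
    finally show ?thesis .
  qed
  also have "(\<kappa> * a) * z \<le> 1 / 6 * z" using \<kappa>a pos by (intro mult_right_mono)
  finally have h1: "SX \<le> 2 * p + z / 6" by simp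
  have h2: "z \<le> 8 * q + 4 / 3 * SX + G / 3 + U / 3"
  proof -
    have "(1 - r) * SS \<le> 2 * (S1 + \<gamma> * SD)" using S by (simp add: field_simps)
    then have "SS \<le> 2 * (S1 + \<gamma> * SD) / (1 - r)" using r by (simp add: field_simps)
    then have "z \<le> \<eta> / L * (2 * (S1 + \<gamma> * SD) / (1 - r))"
      unfolding z_def using L \<eta> by (intro mult_left_mono) auto
    also have "\<dots> = \<eta> / L * (2 * S1 / (1 - r)) + \<eta> / L * (2 * \<gamma> / (1 - r) * SD)"
      by (simp add: add_divide_distrib distrib_left)
    also have "\<eta> / L * (2 * S1 / (1 - r)) = 8 * q"
      by (simp add: q_def)
    also have "\<eta> / L * (2 * \<gamma> / (1 - r) * SD) = (\<kappa> * a) * (SD / L\<^sup>2)"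
      using L by (simp add: \<kappa>_def a_def power2_eq_square mult_ac)
    also have "(\<kappa> * a) * (SD / L\<^sup>2) \<le> 1 / 6 * (SD / L\<^sup>2)"
      using \<kappa>a nonneg by (intro mult_right_mono) auto
    also have "SD / L\<^sup>2 \<le> 8 * SX + 2 * G + 2 * U"
      using D L by (simp add: G_def field_simps)
    finally have "z \<le> 8 * q + 1 / 6 * (8 * SX + 2 * G + 2 * U)" by simp
    then show ?thesis by (simp add: field_simps)
  qed
  have SX: "SX \<le> 18 / 7 * Q + G / 14 + U / 14" using h1 h2 pq pos by linarith
  have "(5 / 6) * SG \<le> (1 - \<eta> * L) * SG" using step nonneg by (intro mult_right_mono) auto
  then have N': "SN + 5 / 6 * SG \<le> 2 * (\<Delta> / \<eta>) + SE" using N by simp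
  have sc: "c * SE \<le> c * (2 * L\<^sup>2 * SX + L\<^sup>2 * U / 2)" if "0 \<le> c" for c
    using E that by (rule mult_left_mono)
  have E2: "\<eta>\<^sup>2 * SE \<le> SX / 18 + U / 72"
  proof -
    have "\<eta>\<^sup>2 * SE \<le> a\<^sup>2 * (2 * SX + U / 2)" using sc[of "\<eta>\<^sup>2"] by (simp add: a_def power_mult_distrib algebra_simps)
    also have "\<dots> \<le> 1 / 36 * (2 * SX + U / 2)" using a2 nonneg by (intro mult_right_mono) auto
    finally show ?thesis by simp
  qed
  have E3: "\<eta> / L * SE \<le> SX / 3 + U / 12"
  proof -
    have "\<eta> / L * SE \<le> a * (2 * SX + U / 2)"
      using sc[of "\<eta> / L"] L \<eta> by (simp add: a_def field_simps power2_eq_square)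
    also have "\<dots> \<le> 1 / 6 * (2 * SX + U / 2)" using a nonneg by (intro mult_right_mono) auto
    finally show ?thesis by simp
  qed
  have "\<eta>\<^sup>2 * (SN + 5 / 6 * SG) \<le> \<eta>\<^sup>2 * (2 * (\<Delta> / \<eta>) + SE)" using N' by (intro mult_left_mono) auto
  then have "\<eta>\<^sup>2 * SN + 5 / 6 * G \<le> 2 * (\<eta> * \<Delta>) + \<eta>\<^sup>2 * SE"
    using \<eta> by (simp add: G_def power2_eq_square distrib_left)
  moreover have "0 \<le> \<eta>\<^sup>2 * SN" using nonneg by simp
  ultimately have GN: "5 / 6 * G \<le> 2 * (\<eta> * \<Delta>) + SX / 18 + U / 72" using E2 by linarith
  have \<eta>\<Delta>: "0 \<le> \<eta> * \<Delta>" using \<eta> nonneg by simp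
  have "SX \<le> 1.6 * (\<eta> * \<Delta>) + 3.2 * Q + 7 / 20 * U"
    using SX GN pos pq nonneg \<eta>\<Delta> by linarith
  then show "SX \<le> 1.6 * \<eta> * \<Delta> + 3.2 * R0 / (1 - r) + 0.35 * U" by (simp add: Q_def)
  have "z + \<eta> / L * SE \<le> 9.6 * (\<eta> * \<Delta>) + 19.2 * Q + 47 / 20 * U"
    using SX GN pos pq nonneg \<eta>\<Delta> h2 E3 by linarith
  then have "L / \<eta> * (z + \<eta> / L * SE) \<le> L / \<eta> * (9.6 * (\<eta> * \<Delta>) + 19.2 * Q + 47 / 20 * U)"
    using L \<eta> by (intro mult_left_mono) auto
  moreover have "L / \<eta> * (z + \<eta> / L * SE) = SS + SE" using L \<eta> by (simp add: z_def distrib_left)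
  moreover have "L / \<eta> * (9.6 * (\<eta> * \<Delta>) + 19.2 * Q + 47 / 20 * U)
      = 9.6 * L * \<Delta> + 19.2 * L * R0 / (\<eta> * (1 - r)) + 2.35 / \<eta> * L * U"
    using \<eta> by (simp add: Q_def distrib_left) (simp add: algebra_simps)
  ultimately show "SS + SE \<le> 9.6 * L * \<Delta> + 19.2 * L * R0 / (\<eta> * (1 - r)) + 2.35 / \<eta> * L * U" by metis
  have "L\<^sup>2 * SX \<le> L\<^sup>2 * (18 / 7 * Q + G / 14 + U / 14)" using SX by (intro mult_left_mono) auto
  then have LSX: "L\<^sup>2 * SX \<le> 18 / 7 * (L\<^sup>2 * Q) + a\<^sup>2 * SG / 14 + (L\<^sup>2 * U) / 14"
    by (simp add: G_def a_def power_mult_distrib algebra_simps)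
  have "a\<^sup>2 * SG \<le> 1 / 36 * SG" using a2 nonneg by (intro mult_right_mono)
  moreover have "0 \<le> L\<^sup>2 * Q" "0 \<le> L\<^sup>2 * U" "0 \<le> \<Delta> / \<eta>" using pq pos nonneg \<eta> by auto
  ultimately have "SN \<le> 3.2 * (\<Delta> / \<eta>) + 12.8 * (L\<^sup>2 * Q) + 2.4 * (L\<^sup>2 * U)"
    using N' E LSX nonneg by linarith
  then show "SN \<le> 3.2 * \<Delta> / \<eta> + 12.8 * L\<^sup>2 * R0 / (1 - r) + 2.4 * U * L\<^sup>2"
    by (simp add: Q_def algebra_simps)
qed

text \<open>
  Subtracting the accumulated increases leaves a decreasing sequence that is bounded below.
\<close>

lemma convergent_of_summable_increase:
  fixes h c :: "nat \<Rightarrow> real"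
  assumes "summable c" and step: "\<And>t. h (Suc t) \<le> h t + c t" and low: "\<And>t. m \<le> h t"
  shows "convergent h"
proof -
  have conv: "convergent (\<lambda>n. \<Sum>t<n. c t)" using assms(1) by (simp add: summable_iff_convergent)
  then obtain B where B: "\<And>n. \<bar>\<Sum>t<n. c t\<bar> \<le> B"
    using convergent_imp_Bseq Bseq_def by (metis real_norm_def)
  define k where "k n = h n - (\<Sum>t<n. c t)" for n
  have dec: "decseq k" using step by (intro decseq_SucI) (simp add: k_def algebra_simps)
  have "m - B \<le> k n" for n using low[of n] B[of n] by (simp add: k_def abs_le_iff)
  then have "convergent k" using dec decseq_convergent convergentI by metis
  then have "convergent (\<lambda>n. k n + (\<Sum>t<n. c t))" using conv by (rule convergent_add)
  then show ?thesis by (simp add: k_def)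
qed

section \<open>The gradient tracking iteration\<close>

text \<open>
  A run of the algorithm. The graph is represented by its spectral consequence \<open>\<rho> < 1\<close>,
  which makes mixing a contraction of the deviations from the average.
\<close>

locale gradient_tracking =
  fixes W :: "real ^ 'n::finite ^ 'n"
    and f :: "'n \<Rightarrow> real ^ 'd \<Rightarrow> real"
    and L \<eta> :: real
    and u :: "nat \<Rightarrow> real"
    and x s g :: "nat \<Rightarrow> 'n \<Rightarrow> real ^ 'd"
  assumes stochastic: "doubly_stochastic W"
    and rho_less_1: "consensus_rho W < 1"
    and L_pos: "0 < L" and step_pos: "0 < \<eta>"
    and smooth: "\<And>i. L_smooth L (f i)"
    and radii_pos: "\<And>t. t \<ge> 1 \<Longrightarrow> u t > 0"
    and radii_antimono: "antimono_on {1..} u"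
    and run: "gradient_tracking_run W f \<eta> u x s g"
    and bounded_below: "bdd_below (range (\<lambda>y. agent_mean (\<lambda>i. f i y)))"
    and step_le: "\<eta> * L \<le> step_bound (consensus_rho W)"
    and radii_summable: "summable (\<lambda>t. (u (t + 1))\<^sup>2)"
begin

abbreviation "r \<equiv> (consensus_rho W)\<^sup>2"
abbreviation "F y \<equiv> agent_mean (\<lambda>i. f i y)"
abbreviation "xbar t \<equiv> agent_mean (x t)"
abbreviation "gbar t \<equiv> agent_mean (g t)"

lemma r_bounds: "0 \<le> r" "r < 1"
  using consensus_rho_nonneg[of W] rho_less_1 by (auto simp: power2_less_1_iff[THEN iffD2] abs_square_less_1)

lemma gradient_F: "gradient F y = agent_mean (\<lambda>i. gradient (f i) y)"
  using smooth by (intro gradient_agent_mean) (simp add: L_smooth_def)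

lemma start: "s 0 = (\<lambda>i. 0)" "g 0 = (\<lambda>i. 0)"
  using run by (auto simp: gradient_tracking_run_def)

lemma run_Suc:
  "g (Suc t) i = grad_est_2d (f i) (x t i) (u (Suc t)) \<and>
   s (Suc t) i = (\<Sum>j\<in>UNIV. W $ i $ j *\<^sub>R (s t j + g (Suc t) j - g t j)) \<and>
   x (Suc t) i = (\<Sum>j\<in>UNIV. W $ i $ j *\<^sub>R (x t j - \<eta> *\<^sub>R s (Suc t) j))"
  using run[unfolded gradient_tracking_run_def, THEN conjunct2, rule_format, of "Suc t" i] by simp

lemma g_Suc: "g (Suc t) i = grad_est_2d (f i) (x t i) (u (Suc t))"
  by (simp only: run_Suc)

lemma s_Suc: "s (Suc t) = mix W (\<lambda>j. s t j + (g (Suc t) j - g t j))"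
  unfolding fun_eq_iff mix_def add_diff_eq using run_Suc by blast

lemma x_Suc: "x (Suc t) = mix W (\<lambda>j. x t j + - \<eta> *\<^sub>R s (Suc t) j)"
  unfolding fun_eq_iff mix_def scaleR_minus_left add_uminus_conv_diff using run_Suc by blast

text \<open>
  The tracking invariant: mixing preserves averages and the corrections telescope, so the average
  tracker is always the current average gradient estimate. Hence the averages perform a gradient
  descent with an inexact gradient.
\<close>

lemma mean_s: "agent_mean (s t) = gbar t"
proof (induction t)
  case 0
  show ?case by (simp add: start)
next
  case (Suc t)
  then show ?case
    unfolding s_Suc agent_mean_mix[OF stochastic] agent_mean_add agent_mean_diff by simp
qed

lemma mean_x: "xbar (Suc t) = xbar t - \<eta> *\<^sub>R gbar (Suc t)"
  unfolding x_Suc agent_mean_mix[OF stochastic] agent_mean_add agent_mean_scaleR mean_s by simp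

lemma consensus_error_Suc:
  "disagreement (x (Suc t)) \<le> (1 + r) / 2 * disagreement (x t)
     + r * (1 + r) / (1 - r) * \<eta>\<^sup>2 * disagreement (s (Suc t))"
proof -
  have "disagreement (x (Suc t)) \<le> r * disagreement (\<lambda>j. x t j + - \<eta> *\<^sub>R s (Suc t) j)"
    by (subst x_Suc) (rule disagreement_mix_le[OF stochastic])
  also have "\<dots> \<le> (1 + r) / 2 * disagreement (x t)
      + r * (1 + r) / (1 - r) * disagreement (\<lambda>j. - \<eta> *\<^sub>R s (Suc t) j)"
    by (rule disagreement_add_contracted[OF r_bounds])
  finally show ?thesis by (simp only: disagreement_scaleR power2_minus mult.assoc)
qed

lemma tracking_error_Suc:
  "disagreement (s (Suc t)) \<le> (1 + r) / 2 * disagreement (s t)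
     + r * (1 + r) / (1 - r) * mean_sq (\<lambda>j. g (Suc t) j - g t j)"
proof -
  have "disagreement (s (Suc t)) \<le> r * disagreement (\<lambda>j. s t j + (g (Suc t) j - g t j))"
    by (subst s_Suc) (rule disagreement_mix_le[OF stochastic])
  also have "\<dots> \<le> (1 + r) / 2 * disagreement (s t)
      + r * (1 + r) / (1 - r) * disagreement (\<lambda>j. g (Suc t) j - g t j)"
    by (rule disagreement_add_contracted[OF r_bounds])
  also have "\<dots> \<le> (1 + r) / 2 * disagreement (s t)
      + r * (1 + r) / (1 - r) * mean_sq (\<lambda>j. g (Suc t) j - g t j)"
    using r_bounds by (intro add_left_mono mult_left_mono disagreement_le_mean_sq) auto
  finally show ?thesis .
qed

lemma estimation_error:
  "(norm (g (Suc t) i - gradient (f i) (x t i)))\<^sup>2 \<le> L\<^sup>2 * (real CARD('d) * (u (Suc t))\<^sup>2) / 4"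
  unfolding g_Suc by (rule grad_est_2d_error[OF smooth radii_pos]) simp

lemma gradient_lipschitz_sq:
  "(norm (gradient (f i) y - gradient (f i) z))\<^sup>2 \<le> L\<^sup>2 * (norm (y - z))\<^sup>2"
proof -
  have "norm (gradient (f i) y - gradient (f i) z) \<le> L * norm (y - z)"
    using smooth by (simp add: L_smooth_def)
  then show ?thesis by (metis norm_ge_zero power_mono power_mult_distrib)
qed

text \<open>
  The recursion for the tracking error is summed from time one on, and this is its initial value: all
  estimates jump from zero to their first values, so this error depends on the initial gradients,
  not just on their changes.
\<close>

lemma first_tracking_error:
  "disagreement (s (Suc 0)) \<le> r * (2 * agent_mean (\<lambda>i. (norm (gradient (f i) (x 0 i)))\<^sup>2)
     + L\<^sup>2 * (real CARD('d) * (u 1)\<^sup>2) / 2)"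
proof -
  let ?c = "L\<^sup>2 * (real CARD('d) * (u 1)\<^sup>2)"
  have "(norm (g (Suc 0) i))\<^sup>2 \<le> 2 * (norm (gradient (f i) (x 0 i)))\<^sup>2 + ?c / 2" for i
    using norm_add_sq_le[of "gradient (f i) (x 0 i)" "g (Suc 0) i - gradient (f i) (x 0 i)"]
      estimation_error[of 0 i] by simp
  then have "mean_sq (g (Suc 0))
      \<le> agent_mean (\<lambda>i. 2 * (norm (gradient (f i) (x 0 i)))\<^sup>2 + ?c / 2)"
    unfolding mean_sq_def by (rule agent_mean_mono)
  then have "mean_sq (g (Suc 0)) \<le> 2 * agent_mean (\<lambda>i. (norm (gradient (f i) (x 0 i)))\<^sup>2) + ?c / 2"
    by (simp only: agent_mean_add agent_mean_mult agent_mean_const)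
  then have "r * mean_sq (g (Suc 0))
      \<le> r * (2 * agent_mean (\<lambda>i. (norm (gradient (f i) (x 0 i)))\<^sup>2) + ?c / 2)"
    using r_bounds by (intro mult_left_mono)
  moreover have "disagreement (s (Suc 0)) \<le> r * disagreement (g (Suc 0))"
    by (subst s_Suc, simp add: start) (rule disagreement_mix_le[OF stochastic])
  moreover have "r * disagreement (g (Suc 0)) \<le> r * mean_sq (g (Suc 0))"
    using r_bounds by (intro mult_left_mono disagreement_le_mean_sq)
  ultimately show ?thesis by linarith
qed

text \<open>
  A change of the estimates comes from the motion of the iterates and from the estimation errors at
  the two times; both of the latter are bounded through the earlier radius, as the radii do not
  increase. The motion splits orthogonally into that of the average, which is the step taken, and
  that of the deviations.
\<close>

lemma estimate_change:
  "mean_sq (\<lambda>i. g (Suc (Suc t)) i - g (Suc t) i)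
     \<le> 4 * L\<^sup>2 * (disagreement (x (Suc t)) + disagreement (x t))
       + 2 * L\<^sup>2 * \<eta>\<^sup>2 * (norm (gbar (Suc t)))\<^sup>2 + 2 * L\<^sup>2 * (real CARD('d) * (u (Suc t))\<^sup>2)"
proof -
  let ?c = "L\<^sup>2 * (real CARD('d) * (u (Suc t))\<^sup>2)"
  have "0 < u (Suc (Suc t))" "u (Suc (Suc t)) \<le> u (Suc t)"
    using radii_pos radii_antimono by (auto simp: monotone_on_def)
  then have u: "L\<^sup>2 * (real CARD('d) * (u (Suc (Suc t)))\<^sup>2) \<le> ?c"
    by (intro mult_left_mono power_mono) auto
  have pt: "(norm (g (Suc (Suc t)) i - g (Suc t) i))\<^sup>2
      \<le> 2 * L\<^sup>2 * (norm (x (Suc t) i - x t i))\<^sup>2 + 2 * ?c" for i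
  proof -
    let ?e = "g (Suc (Suc t)) i - gradient (f i) (x (Suc t) i)"
    let ?e' = "g (Suc t) i - gradient (f i) (x t i)"
    let ?h = "gradient (f i) (x (Suc t) i) - gradient (f i) (x t i)"
    have "(norm (?h + (?e + - ?e')))\<^sup>2 \<le> 2 * (norm ?h)\<^sup>2 + 2 * (norm (?e + - ?e'))\<^sup>2"
      by (rule norm_add_sq_le)
    moreover have "(norm (?e + - ?e'))\<^sup>2 \<le> 2 * (norm ?e)\<^sup>2 + 2 * (norm ?e')\<^sup>2"
      using norm_add_sq_le[of ?e "- ?e'"] by (simp only: norm_minus_cancel)
    moreover have "?h + (?e + - ?e') = g (Suc (Suc t)) i - g (Suc t) i" by simp
    ultimately show ?thesis
      using estimation_error[of "Suc t" i] estimation_error[of t i] u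
        gradient_lipschitz_sq[of i "x (Suc t) i" "x t i"] by (simp only: mult.assoc)
  qed
  have "mean_sq (\<lambda>i. g (Suc (Suc t)) i - g (Suc t) i)
      \<le> agent_mean (\<lambda>i. 2 * L\<^sup>2 * (norm (x (Suc t) i - x t i))\<^sup>2 + 2 * ?c)"
    unfolding mean_sq_def using pt by (rule agent_mean_mono)
  also have "\<dots> = 2 * L\<^sup>2 * mean_sq (\<lambda>i. x (Suc t) i - x t i) + 2 * ?c"
    unfolding mean_sq_def by (simp only: agent_mean_add agent_mean_mult agent_mean_const)
  also have "mean_sq (\<lambda>i. x (Suc t) i - x t i)
      = disagreement (\<lambda>i. x (Suc t) i - x t i) + \<eta>\<^sup>2 * (norm (gbar (Suc t)))\<^sup>2"
    unfolding mean_sq_split agent_mean_diff mean_x by (simp add: power_mult_distrib)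
  also have "2 * L\<^sup>2 * (disagreement (\<lambda>i. x (Suc t) i - x t i) + \<eta>\<^sup>2 * (norm (gbar (Suc t)))\<^sup>2) + 2 * ?c
      \<le> 2 * L\<^sup>2 * ((2 * disagreement (x (Suc t)) + 2 * disagreement (x t))
          + \<eta>\<^sup>2 * (norm (gbar (Suc t)))\<^sup>2) + 2 * ?c"
    by (intro add_right_mono mult_left_mono disagreement_diff_le) simp
  finally show ?thesis by (simp add: algebra_simps)
qed

text \<open>
  The average estimate errs through the finite differences and through evaluating each local gradient
  at the agent's own point instead of the average point.
\<close>

lemma mean_gradient_error:
  "(norm (gbar (Suc t) - gradient F (xbar t)))\<^sup>2
     \<le> 2 * L\<^sup>2 * disagreement (x t) + L\<^sup>2 * (real CARD('d) * (u (Suc t))\<^sup>2) / 2"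
proof -
  let ?c = "L\<^sup>2 * (real CARD('d) * (u (Suc t))\<^sup>2)"
  have pt: "(norm (g (Suc t) i - gradient (f i) (xbar t)))\<^sup>2
      \<le> 2 * L\<^sup>2 * (norm (x t i - xbar t))\<^sup>2 + ?c / 2" for i
    using norm_add_sq_le[of "g (Suc t) i - gradient (f i) (x t i)"
        "gradient (f i) (x t i) - gradient (f i) (xbar t)"]
      estimation_error[of t i] gradient_lipschitz_sq[of i "x t i" "xbar t"] by simp
  have "(norm (gbar (Suc t) - gradient F (xbar t)))\<^sup>2
      \<le> mean_sq (\<lambda>i. g (Suc t) i - gradient (f i) (xbar t))"
    unfolding gradient_F agent_mean_diff[symmetric] by (rule norm_agent_mean_le)
  also have "\<dots> \<le> agent_mean (\<lambda>i. 2 * L\<^sup>2 * (norm (x t i - xbar t))\<^sup>2 + ?c / 2)"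
    unfolding mean_sq_def using pt by (rule agent_mean_mono)
  also have "\<dots> = 2 * L\<^sup>2 * disagreement (x t) + ?c / 2"
    unfolding disagreement_def mean_sq_def by (simp only: agent_mean_add agent_mean_mult agent_mean_const)
  finally show ?thesis .
qed

lemma F_quadratic_upper_bound: "F y \<le> F z + gradient F z \<bullet> (y - z) + L / 2 * (norm (y - z))\<^sup>2"
proof -
  have "F y \<le> agent_mean (\<lambda>i. f i z + gradient (f i) z \<bullet> (y - z) + L / 2 * (norm (y - z))\<^sup>2)"
    using L_smooth_quadratic_bound[OF smooth] by (intro agent_mean_mono) (smt (verit))
  then show ?thesis by (simp only: agent_mean_add agent_mean_inner agent_mean_const gradient_F)
qed

text \<open>
  The quadratic bound along the averaged step, with the inner product of the true and the estimated
  gradient written by polarisation. The negative multiple of the squared estimate is kept: it pays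
  for the motion of the averages in the tracking recursion.
\<close>

lemma descent:
  "F (xbar (Suc t)) \<le> F (xbar t) - \<eta> / 2 * (norm (gradient F (xbar t)))\<^sup>2
     - \<eta> * (1 - \<eta> * L) / 2 * (norm (gbar (Suc t)))\<^sup>2
     + \<eta> / 2 * (norm (gbar (Suc t) - gradient F (xbar t)))\<^sup>2"
proof -
  let ?d = "gradient F (xbar t)" and ?g = "gbar (Suc t)"
  have "F (xbar (Suc t)) \<le> F (xbar t) - \<eta> * (?d \<bullet> ?g) + L / 2 * (\<eta>\<^sup>2 * (norm ?g)\<^sup>2)"
    using F_quadratic_upper_bound[of "xbar (Suc t)" "xbar t"] by (simp add: mean_x power_mult_distrib)
  also have "?d \<bullet> ?g = ((norm ?d)\<^sup>2 + (norm ?g)\<^sup>2 - (norm (?g - ?d))\<^sup>2) / 2"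
    by (simp add: power2_norm_eq_inner inner_diff_left inner_diff_right inner_commute)
  finally show ?thesis by (simp add: field_simps power2_eq_square)
qed

lemma tracking_distance:
  "agent_mean (\<lambda>i. (norm (s (Suc t) i - gradient F (xbar t)))\<^sup>2)
     = disagreement (s (Suc t)) + (norm (gbar (Suc t) - gradient F (xbar t)))\<^sup>2"
  using mean_sq_shift[of "s (Suc t)" "gradient F (xbar t)"] by (simp add: mean_sq_def mean_s)

abbreviation "\<Delta> \<equiv> F (xbar 0) - (INF y. F y)"
abbreviation "R0 \<equiv> R_init W f L \<eta> (u 1) (x 0)"

section \<open>Totals over a time window\<close>

lemma INF_le_F: "(INF y. F y) \<le> F y"
  using bounded_below by (intro cINF_lower) auto

text \<open>
  Without division, the bound on the step size also covers \<open>\<rho> = 0\<close>.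
\<close>

lemma step_conditions:
  "\<eta> * L \<le> 1 / 6" "4 * r * (3 + 4 * r) * (\<eta> * L) \<le> (1 - r)\<^sup>2"
proof -
  show "\<eta> * L \<le> 1 / 6" using step_le by (auto simp: step_bound_def split: if_splits)
  show "4 * r * (3 + 4 * r) * (\<eta> * L) \<le> (1 - r)\<^sup>2"
  proof (cases "consensus_rho W = 0")
    case False
    then have "0 < r" by simp
    then have "0 < 4 * r * (3 + 4 * r)" by (intro mult_pos_pos) linarith+
    moreover have "\<eta> * L \<le> (1 - r)\<^sup>2 / (4 * r * (3 + 4 * r))"
      using step_le False by (simp add: step_bound_def)
    ultimately show ?thesis by (simp add: pos_le_divide_eq mult.commute)
  qed simp
qed

lemma descent_total:
  "F (xbar T) \<le> F (xbar 0) - \<eta> / 2 * (\<Sum>t<T. (norm (gradient F (xbar t)))\<^sup>2)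
     - \<eta> * (1 - \<eta> * L) / 2 * (\<Sum>t<T. (norm (gbar (Suc t)))\<^sup>2)
     + \<eta> / 2 * (\<Sum>t<T. (norm (gbar (Suc t) - gradient F (xbar t)))\<^sup>2)"
proof (induction T)
  case (Suc T)
  then show ?case using descent[of T] by (simp only: sum.lessThan_Suc distrib_left)
qed simp

lemma radii_total: "(\<Sum>t<T. real CARD('d) * (u (Suc t))\<^sup>2) \<le> (real CARD('d) * (\<Sum>t. (u (t + 1))\<^sup>2))"
  using sum_le_suminf[OF radii_summable, of "{..<T}"]
  by (simp add: mult_left_mono flip: sum_distrib_left)

lemma R0_bounds_initial_errors:
  "disagreement (x 0) + \<eta> / (4 * L) * disagreement (s (Suc 0)) \<le> R0"
proof -
  let ?M = "agent_mean (\<lambda>i. (norm (gradient (f i) (x 0 i)))\<^sup>2)"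
  let ?c = "real CARD('d) * (u 1)\<^sup>2"
  have "\<eta> / (4 * L) * disagreement (s (Suc 0)) \<le> \<eta> / (4 * L) * (r * (2 * ?M + L\<^sup>2 * ?c / 2))"
    using first_tracking_error L_pos step_pos by (intro mult_left_mono) auto
  also have "\<dots> = \<eta> * r / (2 * L) * ?M + \<eta> * r * L * ?c / 8"
    using L_pos by (simp add: field_simps power2_eq_square)
  also have "\<dots> \<le> \<eta> * r / (2 * L) * ?M + \<eta> * r * L * ?c / 4"
    using L_pos step_pos by (simp add: field_simps)
  finally show ?thesis
    unfolding R_init_def agent_mean_add agent_mean_mult disagreement_def mean_sq_def
    by (simp add: mult_ac)
qed

text \<open>
  The third total splits the distance from the trackers to the gradient orthogonally into
  tracking error and error of the average estimate.
\<close>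

lemma totals:
  shows "(\<Sum>t<Suc n. (norm (gradient F (xbar t)))\<^sup>2)
      \<le> 3.2 * \<Delta> / \<eta> + 12.8 * L\<^sup>2 * R0 / (1 - r) + 2.4 * (real CARD('d) * (\<Sum>t. (u (t + 1))\<^sup>2)) * L\<^sup>2" (is "?SN \<le> _")
    and "(\<Sum>t<Suc n. disagreement (x t)) \<le> 1.6 * \<eta> * \<Delta> + 3.2 * R0 / (1 - r) + 0.35 * (real CARD('d) * (\<Sum>t. (u (t + 1))\<^sup>2))" (is "?SX \<le> _")
    and "(\<Sum>t<Suc n. disagreement (s (Suc t)))
        + (\<Sum>t<Suc n. (norm (gbar (Suc t) - gradient F (xbar t)))\<^sup>2)
      \<le> 9.6 * L * \<Delta> + 19.2 * L * R0 / (\<eta> * (1 - r)) + 2.35 / \<eta> * L * (real CARD('d) * (\<Sum>t. (u (t + 1))\<^sup>2))" (is "?SS + ?SE \<le> _")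
proof -
  let ?\<gamma> = "r * (1 + r) / (1 - r)"
  let ?SG = "\<Sum>t<Suc n. (norm (gbar (Suc t)))\<^sup>2"
  let ?U = "\<Sum>t<Suc n. real CARD('d) * (u (Suc t))\<^sup>2"
  let ?SD = "\<Sum>t<n. mean_sq (\<lambda>i. g (Suc (Suc t)) i - g (Suc t) i)"
  have \<gamma>: "0 \<le> ?\<gamma>" using r_bounds by simp
  have \<beta>: "0 \<le> (1 + r) / 2" by simp
  have "(1 - (1 + r) / 2) * ?SX
      \<le> disagreement (x 0) + (\<Sum>t<n. ?\<gamma> * \<eta>\<^sup>2 * disagreement (s (Suc t)))"
    by (rule sum_le_of_contraction[OF \<beta>, of "\<lambda>t. disagreement (x t)"])
      (rule disagreement_nonneg consensus_error_Suc)+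
  also have "\<dots> \<le> disagreement (x 0) + ?\<gamma> * \<eta>\<^sup>2 * ?SS"
    unfolding sum_distrib_left[symmetric] using \<gamma>
    by (intro add_left_mono mult_left_mono mult_nonneg_nonneg) (simp_all add: disagreement_nonneg)
  finally have X: "(1 - (1 + r) / 2) * ?SX \<le> disagreement (x 0) + ?\<gamma> * \<eta>\<^sup>2 * ?SS" .
  have "(1 - (1 + r) / 2) * ?SS \<le> disagreement (s (Suc 0))
      + (\<Sum>t<n. ?\<gamma> * mean_sq (\<lambda>i. g (Suc (Suc t)) i - g (Suc t) i))"
    by (rule sum_le_of_contraction[OF \<beta>, of "\<lambda>t. disagreement (s (Suc t))"])
      (rule disagreement_nonneg tracking_error_Suc)+
  then have S: "(1 - (1 + r) / 2) * ?SS \<le> disagreement (s (Suc 0)) + ?\<gamma> * ?SD"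
    by (simp only: sum_distrib_left)
  have D: "?SD \<le> 8 * L\<^sup>2 * ?SX + 2 * L\<^sup>2 * \<eta>\<^sup>2 * ?SG + 2 * L\<^sup>2 * (real CARD('d) * (\<Sum>t. (u (t + 1))\<^sup>2))"
  proof -
    let ?c = "\<lambda>t. real CARD('d) * (u (Suc t))\<^sup>2"
    have "?SD \<le> (\<Sum>t<n. 4 * L\<^sup>2 * (disagreement (x (Suc t)) + disagreement (x t))
        + 2 * L\<^sup>2 * \<eta>\<^sup>2 * (norm (gbar (Suc t)))\<^sup>2 + 2 * L\<^sup>2 * ?c t)"
      by (intro sum_mono estimate_change)
    also have "\<dots> = 4 * L\<^sup>2 * ((\<Sum>t<n. disagreement (x (Suc t))) + (\<Sum>t<n. disagreement (x t)))
        + 2 * L\<^sup>2 * \<eta>\<^sup>2 * (\<Sum>t<n. (norm (gbar (Suc t)))\<^sup>2) + 2 * L\<^sup>2 * (\<Sum>t<n. ?c t)"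
      by (simp only: sum.distrib flip: sum_distrib_left)
    also have "\<dots> \<le> 4 * L\<^sup>2 * (?SX + ?SX) + 2 * L\<^sup>2 * \<eta>\<^sup>2 * ?SG + 2 * L\<^sup>2 * (real CARD('d) * (\<Sum>t. (u (t + 1))\<^sup>2))"
    proof (intro add_mono mult_left_mono)
      show "(\<Sum>t<n. disagreement (x (Suc t))) \<le> ?SX"
        unfolding sum.lessThan_Suc_shift by (simp add: disagreement_nonneg)
      show "(\<Sum>t<n. disagreement (x t)) \<le> ?SX" by (simp add: disagreement_nonneg)
      show "(\<Sum>t<n. ?c t) \<le> (real CARD('d) * (\<Sum>t. (u (t + 1))\<^sup>2))" by (rule radii_total)
    qed simp_all
    finally show ?thesis by (simp only: mult_2[symmetric])
  qed
  have "(INF y. F y) \<le> F (xbar 0) - \<eta> / 2 * ?SN - \<eta> * (1 - \<eta> * L) / 2 * ?SG + \<eta> / 2 * ?SE"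
    using INF_le_F descent_total by (rule order_trans)
  then have "\<eta> * (?SN / 2 + (1 - \<eta> * L) / 2 * ?SG) \<le> \<Delta> + \<eta> * (?SE / 2)"
    by (simp only: distrib_left times_divide_eq_right times_divide_eq_left mult.assoc)
  then have "\<eta> * (?SN / 2 + (1 - \<eta> * L) / 2 * ?SG) / \<eta> \<le> (\<Delta> + \<eta> * (?SE / 2)) / \<eta>"
    using step_pos by (intro divide_right_mono) auto
  then have N: "?SN / 2 + (1 - \<eta> * L) / 2 * ?SG \<le> \<Delta> / \<eta> + ?SE / 2"
    using step_pos by (simp only: add_divide_distrib nonzero_mult_div_cancel_left less_imp_neq[symmetric]) simp
  have "?SE \<le> (\<Sum>t<Suc n. 2 * L\<^sup>2 * disagreement (x t) + L\<^sup>2 * (real CARD('d) * (u (Suc t))\<^sup>2) / 2)"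
    by (intro sum_mono mean_gradient_error)
  also have "\<dots> = 2 * L\<^sup>2 * ?SX + L\<^sup>2 * ?U / 2"
    by (simp only: sum.distrib sum_distrib_left sum_divide_distrib)
  also have "\<dots> \<le> 2 * L\<^sup>2 * ?SX + L\<^sup>2 * (real CARD('d) * (\<Sum>t. (u (t + 1))\<^sup>2)) / 2"
    by (intro add_left_mono divide_right_mono mult_left_mono radii_total) auto
  finally have E: "?SE \<le> 2 * L\<^sup>2 * ?SX + L\<^sup>2 * (real CARD('d) * (\<Sum>t. (u (t + 1))\<^sup>2)) / 2" .
  have pos: "0 \<le> ?SX" "0 \<le> ?SS" "0 \<le> ?SG" "0 \<le> ?SN" "0 \<le> ?SD" "0 \<le> (real CARD('d) * (\<Sum>t. (u (t + 1))\<^sup>2))"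
    "0 \<le> disagreement (x 0)" "0 \<le> disagreement (s (Suc 0))" "0 \<le> \<Delta>"
    using INF_le_F radii_summable
    by (auto intro!: sum_nonneg mult_nonneg_nonneg suminf_nonneg disagreement_nonneg mean_sq_nonneg simp del: sum.lessThan_Suc)
  note bounds = tracking_totals_bounds[OF r_bounds L_pos step_pos step_conditions X S D N E R0_bounds_initial_errors pos]
  show "?SN \<le> 3.2 * \<Delta> / \<eta> + 12.8 * L\<^sup>2 * R0 / (1 - r) + 2.4 * (real CARD('d) * (\<Sum>t. (u (t + 1))\<^sup>2)) * L\<^sup>2" by (rule bounds(1))
  show "?SX \<le> 1.6 * \<eta> * \<Delta> + 3.2 * R0 / (1 - r) + 0.35 * (real CARD('d) * (\<Sum>t. (u (t + 1))\<^sup>2))" by (rule bounds(2))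
  show "?SS + ?SE \<le> 9.6 * L * \<Delta> + 19.2 * L * R0 / (\<eta> * (1 - r)) + 2.35 / \<eta> * L * (real CARD('d) * (\<Sum>t. (u (t + 1))\<^sup>2))" by (rule bounds(3))
qed

text \<open>
  A step increases the objective by at most a multiple of the squared error of the average estimate,
  and these errors are summable by the third total.
\<close>

lemma objective_convergent: "convergent (\<lambda>t. F (xbar t))"
proof -
  let ?e = "\<lambda>t. (norm (gbar (Suc t) - gradient F (xbar t)))\<^sup>2"
  let ?B = "9.6 * L * \<Delta> + 19.2 * L * R0 / (\<eta> * (1 - r)) + 2.35 / \<eta> * L * (real CARD('d) * (\<Sum>t. (u (t + 1))\<^sup>2))"
  have "(\<Sum>t<n. ?e t) \<le> ?B" for n
  proof -
    have "(\<Sum>t<n. ?e t) \<le> (\<Sum>t<Suc n. ?e t)" by simp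
    also have "\<dots> \<le> (\<Sum>t<Suc n. disagreement (s (Suc t))) + (\<Sum>t<Suc n. ?e t)"
      using sum_nonneg[of "{..<Suc n}" "\<lambda>t. disagreement (s (Suc t))"] disagreement_nonneg by force
    also have "\<dots> \<le> ?B" by (rule totals(3))
    finally show ?thesis .
  qed
  then have "summable ?e" by (intro summableI_nonneg_bounded) auto
  then have "summable (\<lambda>t. \<eta> / 2 * ?e t)" by (rule summable_mult)
  moreover have "F (xbar (Suc t)) \<le> F (xbar t) + \<eta> / 2 * ?e t" for t
  proof -
    have "0 \<le> \<eta> / 2 * (norm (gradient F (xbar t)))\<^sup>2" using step_pos by simp
    moreover have "0 \<le> \<eta> * (1 - \<eta> * L) / 2 * (norm (gbar (Suc t)))\<^sup>2"
      using step_pos step_conditions by (intro mult_nonneg_nonneg divide_nonneg_nonneg) auto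
    ultimately show ?thesis using descent[of t] by linarith
  qed
  ultimately show ?thesis by (rule convergent_of_summable_increase) (rule INF_le_F)
qed

end

section \<open>Convergence and rates\<close>

theorem theorem3:
  fixes E :: "('n::finite \<times> 'n) set"
    and W :: "real ^ 'n ^ 'n"
    and f :: "'n \<Rightarrow> real ^ 'd \<Rightarrow> real"
    and F :: "real ^ 'd \<Rightarrow> real"
    and L \<eta> fstar \<rho> R\<^sub>0 R\<^sub>u :: real
    and u :: "nat \<Rightarrow> real"
    and x s g :: "nat \<Rightarrow> 'n \<Rightarrow> real ^ 'd"
    and xbar :: "nat \<Rightarrow> real ^ 'd"
  defines "F \<equiv> \<lambda>y. agent_mean (\<lambda>i. f i y)"
    and "fstar \<equiv> (INF y. F y)"
    and "\<rho> \<equiv> consensus_rho W"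
    and "xbar \<equiv> \<lambda>t. agent_mean (x t)"
    and "R\<^sub>0 \<equiv> R_init W f L \<eta> (u 1) (x 0)"
    and "R\<^sub>u \<equiv> real CARD('d) * (\<Sum>t. (u (t + 1))\<^sup>2)"
  assumes graph: "undirected_connected E"
    and consensus: "consensus_matrix E W"
    and L_pos: "L > 0"
    and smooth: "\<And>i. L_smooth L (f i)"
    and bounded_below: "bdd_below (range F)"
    and step_pos: "\<eta> > 0"
    and step_le: "\<eta> * L \<le> step_bound \<rho>"
    and radii_pos: "\<And>t. t \<ge> 1 \<Longrightarrow> u t > 0"
    and radii_antimono: "antimono_on {1..} u"
    and radii_summable: "summable (\<lambda>t. (u (t + 1))\<^sup>2)"
    and run: "gradient_tracking_run W f \<eta> u x s g"
  shows "convergent (\<lambda>t. F (xbar t)) \<and>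
    (\<forall>t\<ge>1.
      1 / real t * (\<Sum>\<tau>=0..t-1. (norm (gradient F (xbar \<tau>)))\<^sup>2)
        \<le> 1 / real t * (3.2 * (F (xbar 0) - fstar) / \<eta>
                        + 12.8 * L\<^sup>2 * R\<^sub>0 / (1 - \<rho>\<^sup>2) + 2.4 * R\<^sub>u * L\<^sup>2)
    \<and> 1 / real t * (\<Sum>\<tau>=0..t-1. agent_mean (\<lambda>i. (norm (x \<tau> i - xbar \<tau>))\<^sup>2))
        \<le> 1 / real t * (1.6 * \<eta> * (F (xbar 0) - fstar)
                        + 3.2 * R\<^sub>0 / (1 - \<rho>\<^sup>2) + 0.35 * R\<^sub>u)
    \<and> 1 / real t * (\<Sum>\<tau>=1..t. agent_mean (\<lambda>i. (norm (s \<tau> i - gradient F (xbar (\<tau> - 1))))\<^sup>2))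
        \<le> 1 / real t * (9.6 * L * (F (xbar 0) - fstar)
                        + 19.2 * L * R\<^sub>0 / (\<eta> * (1 - \<rho>\<^sup>2)) + 2.35 / \<eta> * L * R\<^sub>u))"
proof -
  interpret gradient_tracking W f L \<eta> u x s g
    using assms consensus_rho_less_1[OF graph consensus]
    by unfold_locales (auto simp: consensus_matrix_def F_def \<rho>_def)
  have window: "{0..n} = {..<Suc n}" for n :: nat by auto
  have shift: "(\<Sum>\<tau>=1..n. h \<tau>) = (\<Sum>\<tau><n. h (Suc \<tau>))" for h :: "nat \<Rightarrow> real" and n
    by (simp only: One_nat_def sum.atLeast1_atMost_eq)
  show ?thesis
  proof (intro conjI allI impI)
    show "convergent (\<lambda>t. F (xbar t))" unfolding F_def xbar_def by (rule objective_convergent)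
  next
    fix t :: nat assume "1 \<le> t"
    then obtain n where t: "t = Suc n" by (cases t) auto
    note unfold = t diff_Suc_1 window F_def fstar_def \<rho>_def xbar_def R\<^sub>0_def R\<^sub>u_def
    show "1 / real t * (\<Sum>\<tau>=0..t-1. (norm (gradient F (xbar \<tau>)))\<^sup>2)
        \<le> 1 / real t * (3.2 * (F (xbar 0) - fstar) / \<eta>
                        + 12.8 * L\<^sup>2 * R\<^sub>0 / (1 - \<rho>\<^sup>2) + 2.4 * R\<^sub>u * L\<^sup>2)"
      unfolding unfold by (intro mult_left_mono totals(1)) simp
    show "1 / real t * (\<Sum>\<tau>=0..t-1. agent_mean (\<lambda>i. (norm (x \<tau> i - xbar \<tau>))\<^sup>2))
        \<le> 1 / real t * (1.6 * \<eta> * (F (xbar 0) - fstar)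
                        + 3.2 * R\<^sub>0 / (1 - \<rho>\<^sup>2) + 0.35 * R\<^sub>u)"
      unfolding unfold
      by (intro mult_left_mono totals(2)[unfolded disagreement_def mean_sq_def]) simp
    show "1 / real t * (\<Sum>\<tau>=1..t. agent_mean (\<lambda>i. (norm (s \<tau> i - gradient F (xbar (\<tau> - 1))))\<^sup>2))
        \<le> 1 / real t * (9.6 * L * (F (xbar 0) - fstar)
                        + 19.2 * L * R\<^sub>0 / (\<eta> * (1 - \<rho>\<^sup>2)) + 2.35 / \<eta> * L * R\<^sub>u)"
      unfolding unfold shift tracking_distance sum.distrib
      by (intro mult_left_mono totals(3)) simp
  qed
qed

end
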